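(* Let $P\subset\mathbb{R}^d$ be a simple $d$-polytope with $n>d+1\geq4$ vertices, $m$ facets, and $h$-vector $h(P)=(h_0,\dots,h_d)$. For a fixed generic objective function $c$ and an arbitrary normalization $\eta$, the number of coherent arborescences of $(P,c)$ with respect to $\eta$ is strictly less than $$1^{h_1}2^{h_2}\cdots d^{h_d}-2(n-m-2).$$
   Context: A $d$-polytope is simple if every vertex is incident to exactly $d$ edges. $c\in\mathbb{R}^d$ is generic for $P$ if $c^tu\neq c^tv$ for all edges $uv$; it orients each edge towards the endpoint with larger $c$-value and has a unique maximizing vertex $v_{opt}$. The entry $h_i$ of the $h$-vector is the number of vertices with in-degree $i$ in this orientation (for simple $P$ this is independent of the generic $c$). $\mathrm{Nb}_{P,c}(v)$ is the set of vertices $u$ adjacent to $v$ with $c^tu>c^tv$. A normalization is a function $\eta:\mathbb{R}^d\to\mathbb{R}$ with $\eta(u-v)\neq0$ whenever $u\in\mathrm{Nb}_{P,c}(v)$. A coherent arborescence of $(P,c)$ with respect to $\eta$ is a map $\mathcal{A}:V(P)\to V(P)$ for which there is a weight $w\in\mathbb{R}^d$ such that $\mathcal{A}(v_{opt})=v_{opt}$ and, for every $v\neq v_{opt}$, $\mathcal{A}(v)$ is the unique maximizer of $\frac{w^t(u-v)}{\eta(u-v)}$ over $u\in\mathrm{Nb}_{P,c}(v)$. *)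

theory Defs
  imports "HOL-Analysis.Analysis" "HOL-Library.FuncSet"
begin

definition vertices :: "'a::euclidean_space set \<Rightarrow> 'a set" where
  "vertices P = {v. v extreme_point_of P}"

definition adjacent :: "'a::euclidean_space set \<Rightarrow> 'a \<Rightarrow> 'a \<Rightarrow> bool" where
  "adjacent P u v \<longleftrightarrow> u \<in> vertices P \<and> v \<in> vertices P \<and> closed_segment u v edge_of P"

text \<open>A full-dimensional simple polytope in the ambient space, which plays the role
  of \<open>\<real>\<^sup>d\<close> with \<open>d = DIM('a)\<close>.\<close>

definition simple_polytope :: "'a::euclidean_space set \<Rightarrow> bool" where
  "simple_polytope P \<longleftrightarrow> polytope P \<and> aff_dim P = int DIM('a) \<and>
     (\<forall>v \<in> vertices P. card {e. e edge_of P \<and> v \<in> e} = DIM('a))"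

definition generic :: "'a::euclidean_space set \<Rightarrow> 'a \<Rightarrow> bool" where
  "generic P c \<longleftrightarrow> (\<forall>u v. adjacent P u v \<longrightarrow> c \<bullet> u \<noteq> c \<bullet> v)"

text \<open>The maximizing vertex is unique when \<open>P\<close> is a nonempty polytope and \<open>c\<close> is generic.\<close>

definition v_opt :: "'a::euclidean_space set \<Rightarrow> 'a \<Rightarrow> 'a" where
  "v_opt P c = (THE v. v \<in> vertices P \<and> (\<forall>u \<in> vertices P. c \<bullet> u \<le> c \<bullet> v))"

definition Nb :: "'a::euclidean_space set \<Rightarrow> 'a \<Rightarrow> 'a \<Rightarrow> 'a set" where
  "Nb P c v = {u. adjacent P u v \<and> c \<bullet> u > c \<bullet> v}"

definition in_degree :: "'a::euclidean_space set \<Rightarrow> 'a \<Rightarrow> 'a \<Rightarrow> nat" where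
  "in_degree P c v = card {u. adjacent P u v \<and> c \<bullet> u < c \<bullet> v}"

text \<open>The \<open>h\<close>-vector, read off from the orientation induced by a generic \<open>c\<close>; for simple
  polytopes it does not depend on the choice of \<open>c\<close>.\<close>

definition h_vector :: "'a::euclidean_space set \<Rightarrow> 'a \<Rightarrow> nat \<Rightarrow> nat" where
  "h_vector P c i = card {v \<in> vertices P. in_degree P c v = i}"

definition normalization :: "'a::euclidean_space set \<Rightarrow> 'a \<Rightarrow> ('a \<Rightarrow> real) \<Rightarrow> bool" where
  "normalization P c \<eta> \<longleftrightarrow> (\<forall>v \<in> vertices P. \<forall>u \<in> Nb P c v. \<eta> (u - v) \<noteq> 0)"

text \<open>Maps \<open>V(P) \<Rightarrow> V(P)\<close> are extensional functions, so that each map is counted once.\<close>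

definition coherent_arborescences ::
    "'a::euclidean_space set \<Rightarrow> 'a \<Rightarrow> ('a \<Rightarrow> real) \<Rightarrow> ('a \<Rightarrow> 'a) set" where
  "coherent_arborescences P c \<eta> =
     {A \<in> vertices P \<rightarrow>\<^sub>E vertices P.
        A (v_opt P c) = v_opt P c \<and>
        (\<exists>w. \<forall>v \<in> vertices P - {v_opt P c}.
           A v \<in> Nb P c v \<and>
           (\<forall>u \<in> Nb P c v - {A v}.
              (w \<bullet> (u - v)) / \<eta> (u - v) < (w \<bullet> (A v - v)) / \<eta> (A v - v)))}"

lemma finite_coherent_arborescences:
  assumes "polytope P"
  shows "finite (coherent_arborescences P c \<eta>)"
proof -
  have "finite (vertices P)"
    unfolding vertices_def
    using assms by (simp add: finite_polyhedron_extreme_points polytope_imp_polyhedron)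
  then have "finite (vertices P \<rightarrow>\<^sub>E vertices P)"
    by (simp add: finite_PiE)
  then show ?thesis
    by (rule rev_finite_subset) (auto simp: coherent_arborescences_def)
qed

end

theory Submission
  imports Defs
begin

text \<open>At a vertex \<open>v\<close> of a simple polytope the edge directions form a basis, so the nonempty faces
  correspond to the pairs \<open>(v, S)\<close> with \<open>S\<close> a set of lower neighbours of \<open>v\<close>, where \<open>v\<close> is the top
  of the face. Counting faces by dimension for \<open>c\<close> and \<open>-c\<close> shows that in-degrees and out-degrees
  have the same distribution; hence the product is the number of all arborescences. Counting
  facets shows that at most \<open>m - d\<close> vertices have out-degree \<open>1\<close>, so at least \<open>n - m + d - 1\<close>
  vertices have two distinct upper neighbours. Restricting to two choices at each of them, a
  linear relation among \<open>d + 1\<close> of the differences of normalized edge directions forbids two sign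
  patterns on those \<open>d + 1\<close> vertices. With \<open>k = n - m - 2 \<ge> 0\<close> this makes at least
  \<open>2 * 2 ^ k > 2 * k\<close> arborescences incoherent.\<close>

section \<open>Local structure of simple polytopes\<close>

text \<open>The cone of \<open>P\<close> at \<open>v\<close> is pointed because \<open>v\<close> is
  extreme, so an irredundant set of generators among the vertices consists of extreme rays, and
  these run along edges.\<close>

lemma cone_generated_by_neighbours:
  fixes P :: "'a::euclidean_space set"
  assumes P: "polytope P" and v: "v \<in> vertices P"
  obtains G where "finite G" "G \<subseteq> {u. adjacent P u v}"
    and "\<And>x. x \<in> P \<Longrightarrow> \<exists>l. (\<forall>u\<in>G. 0 \<le> l u) \<and> x - v = (\<Sum>u\<in>G. l u *\<^sub>R (u - v))"
proof -
  define V where "V = vertices P"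
  define gen where "gen G \<longleftrightarrow> G \<subseteq> V - {v} \<and>
    (\<forall>x\<in>P. \<exists>l. (\<forall>u\<in>G. 0 \<le> l u) \<and> x - v = (\<Sum>u\<in>G. l u *\<^sub>R (u - v)))" for G
  have finV: "finite V"
    unfolding V_def vertices_def
    using P by (simp add: finite_polyhedron_extreme_points polytope_imp_polyhedron)
  have hull: "P = convex hull V"
    unfolding V_def vertices_def
    using Krein_Milman_Minkowski[of P] P polytope_imp_compact polytope_imp_convex by blast
  have convP: "convex P" using P polytope_imp_convex by blast
  have VP: "V \<subseteq> P" unfolding V_def vertices_def extreme_point_of_def by blast
  have vV: "v \<in> V" and vext: "v extreme_point_of P" using v by (auto simp: V_def vertices_def)
  \<comment> \<open>In a convex combination of all vertices the term at \<open>v\<close> drops out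
    after translation by \<open>- v\<close>.\<close>
  have "gen (V - {v})"
    unfolding gen_def
  proof (intro conjI ballI)
    fix x assume "x \<in> P"
    then obtain l where l: "\<forall>u\<in>V. 0 \<le> l u" "sum l V = 1" "(\<Sum>u\<in>V. l u *\<^sub>R u) = x"
      using hull convex_hull_finite[OF finV] by auto
    have "x - v = (\<Sum>u\<in>V. l u *\<^sub>R (u - v))"
      using l by (simp add: scaleR_diff_right sum_subtractf flip: scaleR_sum_left)
    also have "\<dots> = (\<Sum>u\<in>V - {v}. l u *\<^sub>R (u - v))"
      by (rule sum.mono_neutral_right) (use finV in auto)
    finally show "\<exists>l. (\<forall>u\<in>V - {v}. 0 \<le> l u) \<and> x - v = (\<Sum>u\<in>V - {v}. l u *\<^sub>R (u - v))"
      using l(1) by (intro exI[of _ l]) auto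
  qed simp
  text \<open>Minimality of the generating set \<open>G\<close> makes each of its rays a face of \<open>P\<close>, hence an edge.\<close>
  then obtain G where G: "gen G" and least: "\<And>H. gen H \<Longrightarrow> card G \<le> card H"
    using ex_has_least_nat[of gen _ card] by blast
  have GV: "G \<subseteq> V - {v}" using G by (simp add: gen_def)
  then have finG: "finite G" using finV finite_subset by blast
  \<comment> \<open>A generator in the cone of the others could be dropped, giving a smaller
    generating set.\<close>
  have irred: False if x: "x \<in> G" and k: "\<forall>u\<in>G - {x}. 0 \<le> k u"
    and xk: "x - v = (\<Sum>u\<in>G - {x}. k u *\<^sub>R (u - v))" for x k
  proof -
    have "gen (G - {x})"
      unfolding gen_def
    proof (intro conjI ballI)
      show "G - {x} \<subseteq> V - {v}" using GV by blast
      fix y assume "y \<in> P"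
      then obtain l where l: "\<forall>u\<in>G. 0 \<le> l u" "y - v = (\<Sum>u\<in>G. l u *\<^sub>R (u - v))"
        using G unfolding gen_def by blast
      have "y - v = l x *\<^sub>R (x - v) + (\<Sum>u\<in>G - {x}. l u *\<^sub>R (u - v))"
        using l(2) x finG by (simp add: sum.remove)
      also have "\<dots> = (\<Sum>u\<in>G - {x}. (l x * k u + l u) *\<^sub>R (u - v))"
        unfolding xk by (simp add: scaleR_add_left sum.distrib scaleR_sum_right)
      finally show "\<exists>l. (\<forall>u\<in>G - {x}. 0 \<le> l u) \<and> y - v = (\<Sum>u\<in>G - {x}. l u *\<^sub>R (u - v))"
        using l(1) k x by (intro exI[of _ "\<lambda>u. l x * k u + l u"]) auto
    qed
    then have "card G \<le> card (G - {x})" by (rule least)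
    then show False using card_Diff1_less[OF finG x] by simp
  qed
  \<comment> \<open>After division by the total weight, a nontrivial vanishing combination would
    exhibit \<open>v\<close> as a convex combination of other vertices.\<close>
  have pointed: "l u = 0" if l: "\<forall>u\<in>G. 0 \<le> l u" and eq: "(\<Sum>u\<in>G. l u *\<^sub>R (u - v)) = 0"
    and u: "u \<in> G" for l u
  proof (rule ccontr)
    assume "l u \<noteq> 0"
    then have pos: "sum l G > 0"
      using l u finG by (intro sum_pos2[of G u]) auto
    have "sum l G *\<^sub>R v = (\<Sum>u\<in>G. l u *\<^sub>R u)"
      using eq by (simp add: scaleR_diff_right sum_subtractf flip: scaleR_sum_left)
    then have "v = (1 / sum l G) *\<^sub>R (\<Sum>u\<in>G. l u *\<^sub>R u)"
      using pos by (simp flip: \<open>sum l G *\<^sub>R v = (\<Sum>u\<in>G. l u *\<^sub>R u)\<close>)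
    also have "\<dots> = (\<Sum>u\<in>G. (l u / sum l G) *\<^sub>R u)"
      by (simp add: scaleR_sum_right)
    finally have "v = (\<Sum>u\<in>G. (l u / sum l G) *\<^sub>R u)" .
    moreover have "(\<Sum>u\<in>G. l u / sum l G) = 1"
      using pos by (simp flip: sum_divide_distrib)
    moreover have "\<forall>u\<in>G. 0 \<le> l u / sum l G" using l pos by simp
    ultimately have vG: "v \<in> convex hull G"
      unfolding convex_hull_finite[OF finG] by (auto intro!: exI[of _ "\<lambda>u. l u / sum l G"])
    have "convex hull G \<subseteq> P" using hull GV by (metis Diff_subset hull_mono subset_trans)
    then have "v extreme_point_of convex hull G"
      using vext vG unfolding extreme_point_of_def by blast
    then have "v \<in> G" by (rule extreme_point_of_convex_hull)
    then show False using GV by blast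
  qed
  have "adjacent P x v" if x: "x \<in> G" for x
  proof -
    have xP: "x \<in> P" and xv: "x \<noteq> v" and xext: "x extreme_point_of P" and xV: "x \<in> V"
      using x GV VP by (auto simp: V_def vertices_def)
    have vP: "v \<in> P" using vV VP by blast
    have segP: "closed_segment v x \<subseteq> P" using xP vP convP by (simp add: closed_segment_subset)
    \<comment> \<open>A point of \<open>P\<close> on the ray beyond \<open>x\<close> would put the
      vertex \<open>x\<close> inside an open segment starting at \<open>v\<close>.\<close>
    have ray: "y \<in> closed_segment v x" if y: "y \<in> P" "y - v = r *\<^sub>R (x - v)" "r \<ge> 0" for y r
    proof (cases "r \<le> 1")
      case True
      then show ?thesis using y(2,3) unfolding in_segment
        by (intro exI[of _ r]) (auto simp: algebra_simps)
    next
      case False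
      have "y \<noteq> v" using False y(2) xv by auto
      moreover have "x = (1 - 1/r) *\<^sub>R v + (1/r) *\<^sub>R y"
      proof -
        have "y = v + r *\<^sub>R (x - v)" using y(2) by (simp add: algebra_simps)
        then have "(1/r) *\<^sub>R y = (1/r) *\<^sub>R v + (x - v)"
          using False by (simp add: scaleR_add_right)
        then show ?thesis by (simp add: algebra_simps)
      qed
      ultimately have "x \<in> open_segment v y"
        using False unfolding in_segment by (intro conjI exI[of _ "1/r"]) auto
      then show ?thesis using xext vP y(1) unfolding extreme_point_of_def by blast
    qed
    have "closed_segment v x face_of P"
      unfolding face_of_def
    proof (intro conjI ballI impI segP convex_closed_segment)
      fix a b z assume ab: "a \<in> P" "b \<in> P" and z: "z \<in> closed_segment v x"
        and zab: "z \<in> open_segment a b"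
      obtain la where la: "\<forall>u\<in>G. 0 \<le> la u" "a - v = (\<Sum>u\<in>G. la u *\<^sub>R (u - v))"
        using G ab unfolding gen_def by blast
      obtain lb where lb: "\<forall>u\<in>G. 0 \<le> lb u" "b - v = (\<Sum>u\<in>G. lb u *\<^sub>R (u - v))"
        using G ab unfolding gen_def by blast
      obtain t where t: "0 < t" "t < 1" "z = (1 - t) *\<^sub>R a + t *\<^sub>R b"
        using zab unfolding in_segment by blast
      obtain r where r: "0 \<le> r" "r \<le> 1" "z = (1 - r) *\<^sub>R v + r *\<^sub>R x"
        using z unfolding in_segment by blast
      define g where "g u = (1 - t) * la u + t * lb u" for u
      have g0: "\<forall>u\<in>G. 0 \<le> g u" using la(1) lb(1) t by (auto simp: g_def)
      have "(\<Sum>u\<in>G. g u *\<^sub>R (u - v)) = (1 - t) *\<^sub>R (a - v) + t *\<^sub>R (b - v)"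
        unfolding la lb g_def by (simp add: scaleR_add_left sum.distrib scaleR_sum_right)
      also have "\<dots> = z - v" using t(3) by (simp add: algebra_simps)
      also have "\<dots> = r *\<^sub>R (x - v)" using r(3) by (simp add: algebra_simps)
      finally have eq: "(\<Sum>u\<in>G. g u *\<^sub>R (u - v)) = r *\<^sub>R (x - v)" .
      then have eq': "g x *\<^sub>R (x - v) + (\<Sum>u\<in>G - {x}. g u *\<^sub>R (u - v)) = r *\<^sub>R (x - v)"
        using x finG by (simp add: sum.remove)
      \<comment> \<open>If \<open>g x\<close> were smaller than \<open>r\<close>, solving for
        \<open>x - v\<close> would place it in the cone of \<open>G - {x}\<close>.\<close>
      have "r \<le> g x"
      proof (rule ccontr)
        assume "\<not> r \<le> g x"
        then have rg: "r - g x > 0" by simp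
        have "(r - g x) *\<^sub>R (x - v) = (\<Sum>u\<in>G - {x}. g u *\<^sub>R (u - v))"
          using eq' by (simp add: algebra_simps)
        then have "(1 / (r - g x)) *\<^sub>R ((r - g x) *\<^sub>R (x - v))
            = (\<Sum>u\<in>G - {x}. (g u / (r - g x)) *\<^sub>R (u - v))"
          by (simp add: scaleR_sum_right)
        then have "x - v = (\<Sum>u\<in>G - {x}. (g u / (r - g x)) *\<^sub>R (u - v))"
          using rg by simp
        then show False using irred[OF x, of "\<lambda>u. g u / (r - g x)"] g0 rg by simp
      qed
      \<comment> \<open>\<open>h\<close> collects the whole relation on one side. Pointedness makes
        it vanish, so \<open>a\<close> and \<open>b\<close> have no component off the ray of
        \<open>x\<close>.\<close>
      define h where "h u = (if u = x then g x - r else g u)" for u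
      have "(\<Sum>u\<in>G. h u *\<^sub>R (u - v)) = (g x - r) *\<^sub>R (x - v) + (\<Sum>u\<in>G - {x}. g u *\<^sub>R (u - v))"
        using x finG by (simp add: sum.remove h_def)
      also have "\<dots> = 0" using eq' by (simp add: algebra_simps)
      finally have "(\<Sum>u\<in>G. h u *\<^sub>R (u - v)) = 0" .
      moreover have "\<forall>u\<in>G. 0 \<le> h u" using g0 \<open>r \<le> g x\<close> by (auto simp: h_def)
      ultimately have h0: "h u = 0" if "u \<in> G" for u using pointed that by blast
      have g_zero: "g u = 0" if "u \<in> G - {x}" for u
        using h0[of u] that by (simp add: h_def)
      have zero: "la u = 0 \<and> lb u = 0" if u: "u \<in> G - {x}" for u
      proof -
        have "0 \<le> la u" "0 \<le> lb u" using la(1) lb(1) u by auto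
        moreover have "(1 - t) * la u + t * lb u = 0" using g_zero[OF u] by (simp add: g_def)
        ultimately show ?thesis using t
          by (smt (verit) mult_nonneg_nonneg mult_eq_0_iff)
      qed
      have "a - v = la x *\<^sub>R (x - v)"
        using la(2) x finG zero by (simp add: sum.remove)
      moreover have "b - v = lb x *\<^sub>R (x - v)"
        using lb(2) x finG zero by (simp add: sum.remove)
      ultimately show "a \<in> closed_segment v x" "b \<in> closed_segment v x"
        using ray ab la(1) lb(1) x by blast+
    qed
    moreover have "aff_dim (closed_segment v x) = 1"
      using xv by (simp add: segment_convex_hull aff_dim_convex_hull aff_dim_2)
    ultimately have "closed_segment x v edge_of P"
      by (simp add: edge_of_def closed_segment_commute)
    then show ?thesis using xV vV by (simp add: adjacent_def V_def)
  qed
  then show ?thesis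
    using that[of G] finG G unfolding gen_def by blast
qed

text \<open>Simplicity leaves at most \<open>DIM('a)\<close> neighbours, and full dimension makes
  the generating neighbours span the whole space. The two bounds meet, so every neighbour is a
  generator and the directions form a basis.\<close>

lemma simple_vertex_basis:
  fixes P :: "'a::euclidean_space set"
  assumes P: "simple_polytope P" and v: "v \<in> vertices P"
  defines "N \<equiv> {u. adjacent P u v}"
  shows "finite N" "card N = DIM('a)" "independent ((\<lambda>u. u - v) ` N)"
    and "\<And>x. x \<in> P \<Longrightarrow> \<exists>l. (\<forall>u\<in>N. 0 \<le> l u) \<and> x - v = (\<Sum>u\<in>N. l u *\<^sub>R (u - v))"
proof -
  have poly: "polytope P" and dimP: "aff_dim P = int DIM('a)"
    and cardE: "card {e. e edge_of P \<and> v \<in> e} = DIM('a)"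
    using P v by (auto simp: simple_polytope_def)
  obtain G where G: "finite G" "G \<subseteq> N"
    and gen: "\<And>x. x \<in> P \<Longrightarrow> \<exists>l. (\<forall>u\<in>G. 0 \<le> l u) \<and> x - v = (\<Sum>u\<in>G. l u *\<^sub>R (u - v))"
    using cone_generated_by_neighbours[OF poly v] unfolding N_def by blast
  \<comment> \<open>An infinite set has \<open>card\<close> equal to 0, whereas the dimension is
    positive.\<close>
  have finE: "finite {e. e edge_of P \<and> v \<in> e}"
    using cardE by (metis DIM_positive card.infinite less_irrefl)
  have inj: "inj_on (\<lambda>u. closed_segment u v) N"
    by (auto simp: inj_on_def closed_segment_eq doubleton_eq_iff)
  have sub: "(\<lambda>u. closed_segment u v) ` N \<subseteq> {e. e edge_of P \<and> v \<in> e}"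
    by (auto simp: N_def adjacent_def)
  show finN: "finite N" using finE inj sub by (metis finite_imageD finite_subset)
  have cardN: "card N \<le> DIM('a)"
    using card_inj_on_le[OF inj sub finE] cardE by simp
  have vP: "v \<in> P" using v by (auto simp: vertices_def extreme_point_of_def)
  have "(\<lambda>x. - v + x) ` P \<subseteq> span ((\<lambda>u. u - v) ` G)"
  proof (clarify)
    fix x assume "x \<in> P"
    then obtain l where "x - v = (\<Sum>u\<in>G. l u *\<^sub>R (u - v))" using gen by blast
    then have "x - v \<in> span ((\<lambda>u. u - v) ` G)"
      by (simp add: span_sum span_scale span_base)
    then show "- v + x \<in> span ((\<lambda>u. u - v) ` G)" by (simp add: algebra_simps)
  qed
  then have "dim ((\<lambda>x. - v + x) ` P) \<le> dim ((\<lambda>u. u - v) ` G)"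
    by (rule dim_mono)
  moreover have "int (dim ((\<lambda>x. - v + x) ` P)) = int DIM('a)"
    using aff_dim_eq_dim[of v P] dimP vP by (simp add: hull_inc)
  ultimately have dimG: "DIM('a) \<le> dim ((\<lambda>u. u - v) ` G)" by simp
  also have "\<dots> \<le> card ((\<lambda>u. u - v) ` G)" using G(1) by (intro dim_le_card') auto
  also have "\<dots> \<le> card G" using G(1) by (rule card_image_le)
  finally have "DIM('a) \<le> card G" .
  then have GN: "G = N"
    using cardN G finN by (metis card_seteq le_trans)
  with \<open>DIM('a) \<le> card G\<close> cardN show cardN': "card N = DIM('a)" by simp
  show "independent ((\<lambda>u. u - v) ` N)"
  proof (rule card_le_dim_spanning[of _ UNIV])
    show "UNIV \<subseteq> span ((\<lambda>u. u - v) ` N)"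
      using dimG dim_eq_full[of "(\<lambda>u. u - v) ` N"] dim_subset_UNIV[of "(\<lambda>u. u - v) ` N"] GN by auto
    show "card ((\<lambda>u. u - v) ` N) \<le> dim (UNIV::'a set)"
      using cardN' card_image_le[OF finN, of "\<lambda>u. u - v"] by simp
  qed (use finN in auto)
  show "\<And>x. x \<in> P \<Longrightarrow> \<exists>l. (\<forall>u\<in>N. 0 \<le> l u) \<and> x - v = (\<Sum>u\<in>N. l u *\<^sub>R (u - v))"
    using gen GN by simp
qed

section \<open>Faces through a simple vertex\<close>

text \<open>For \<open>S\<close> a set of neighbours of a simple vertex \<open>v\<close>, this is
  the face through \<open>v\<close> whose edges at \<open>v\<close> lead exactly to
  \<open>S\<close>.\<close>

definition span_face :: "'a::euclidean_space set \<Rightarrow> 'a \<Rightarrow> 'a set \<Rightarrow> 'a set" where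
  "span_face P v S = {x \<in> P. x - v \<in> span ((\<lambda>u. u - v) ` S)}"

text \<open>Values can be prescribed on the edge directions at \<open>v\<close> because these are
  independent. The values 0 and 1 make \<open>a\<close> a supporting functional for the face spanned
  by \<open>S\<close>.\<close>

lemma neighbour_functional:
  fixes P :: "'a::euclidean_space set"
  assumes P: "simple_polytope P" and v: "v \<in> vertices P"
  shows "\<exists>a. \<forall>u. adjacent P u v \<longrightarrow> a \<bullet> (u - v) = (if u \<in> S then 0 else 1)"
proof -
  define B where "B = (\<lambda>u. u - v) ` {u. adjacent P u v}"
  have "independent B" using simple_vertex_basis(3)[OF P v] by (simp add: B_def)
  then obtain g :: "'a \<Rightarrow> real" where g: "linear g" "\<forall>x\<in>B. g x = (if x + v \<in> S then 0 else 1)"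
    using linear_independent_extend[of B "\<lambda>x. if x + v \<in> S then 0 else 1"] by blast
  \<comment> \<open>The adjoint of \<open>g\<close> at 1 represents \<open>g\<close> as an inner
    product.\<close>
  have "adjoint g 1 \<bullet> x = g x" for x
    using adjoint_works[OF g(1), of x 1] by (simp add: inner_commute)
  then show ?thesis using g(2) by (auto simp: B_def intro!: exI[of _ "adjoint g 1"])
qed

text \<open>The functional of \<open>neighbour_functional\<close> vanishes at \<open>x - v\<close>,
  where it equals the sum of the coefficients outside \<open>S\<close>; these are nonnegative, hence
  all zero.\<close>

lemma span_face_coeffs:
  fixes P :: "'a::euclidean_space set"
  assumes P: "simple_polytope P" and v: "v \<in> vertices P"
    and S: "S \<subseteq> {u. adjacent P u v}" and x: "x \<in> span_face P v S"
  obtains l where "\<And>u. u \<in> S \<Longrightarrow> 0 \<le> l u" "x - v = (\<Sum>u\<in>S. l u *\<^sub>R (u - v))"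
proof -
  define N where "N = {u. adjacent P u v}"
  note basis = simple_vertex_basis[OF P v, folded N_def]
  obtain a where a: "\<And>u. u \<in> N \<Longrightarrow> a \<bullet> (u - v) = (if u \<in> S then 0 else 1)"
    using neighbour_functional[OF P v, of S] by (auto simp: N_def)
  have xP: "x \<in> P" and xs: "x - v \<in> span ((\<lambda>u. u - v) ` S)" using x by (auto simp: span_face_def)
  obtain l where l: "\<forall>u\<in>N. 0 \<le> l u" "x - v = (\<Sum>u\<in>N. l u *\<^sub>R (u - v))"
    using basis(4)[OF xP] by blast
  have "a \<bullet> (x - v) = 0"
    using xs by (rule span_induct) (use a S in \<open>auto simp: N_def subspace_hyperplane\<close>)
  moreover have "a \<bullet> (x - v) = (\<Sum>u\<in>N. l u * (if u \<in> S then 0 else 1))"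
    unfolding l(2) inner_sum_right by (rule sum.cong) (use a in auto)
  ultimately have "\<forall>u\<in>N. l u * (if u \<in> S then 0 else 1) = 0"
    using sum_nonneg_eq_0_iff[OF basis(1), of "\<lambda>u. l u * (if u \<in> S then 0 else 1)"] l(1) by auto
  then have "(\<Sum>u\<in>N. l u *\<^sub>R (u - v)) = (\<Sum>u\<in>S. l u *\<^sub>R (u - v))"
    using S basis(1) by (intro sum.mono_neutral_right) (auto simp: N_def split: if_splits)
  then show ?thesis using that[of l] l S by (auto simp: N_def)
qed

text \<open>On \<open>P\<close> the supporting functional is smallest exactly on the slice, which is
  therefore an exposed face. The independent directions to \<open>S\<close> lie in it and span
  it.\<close>

lemma span_face_face_of:
  fixes P :: "'a::euclidean_space set"
  assumes P: "simple_polytope P" and v: "v \<in> vertices P"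
    and S: "S \<subseteq> {u. adjacent P u v}"
  shows "span_face P v S face_of P" "v \<in> span_face P v S"
    and "span_face P v S \<inter> {u. adjacent P u v} = S"
    and "aff_dim (span_face P v S) = int (card S)"
proof -
  define N where "N = {u. adjacent P u v}"
  note basis = simple_vertex_basis[OF P v, folded N_def]
  have SN: "S \<subseteq> N" using S by (simp add: N_def)
  then have finS: "finite S" using basis(1) finite_subset by blast
  obtain a where a: "\<And>u. u \<in> N \<Longrightarrow> a \<bullet> (u - v) = (if u \<in> S then 0 else 1)"
    using neighbour_functional[OF P v, of S] by (auto simp: N_def)
  have NP: "N \<subseteq> P" and vP: "v \<in> P"
    using v by (auto simp: N_def adjacent_def vertices_def extreme_point_of_def)
  have a0: "a \<bullet> z = 0" if "z \<in> span ((\<lambda>u. u - v) ` S)" for z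
    using that by (rule span_induct) (use a SN in \<open>auto simp: subspace_hyperplane\<close>)
  have coeff: "a \<bullet> (x - v) \<ge> 0 \<and> (a \<bullet> (x - v) = 0 \<longrightarrow> x - v \<in> span ((\<lambda>u. u - v) ` S))"
    if xP: "x \<in> P" for x
  proof -
    obtain l where l: "\<forall>u\<in>N. 0 \<le> l u" "x - v = (\<Sum>u\<in>N. l u *\<^sub>R (u - v))"
      using basis(4)[OF xP] by blast
    have eq: "a \<bullet> (x - v) = (\<Sum>u\<in>N. l u * (if u \<in> S then 0 else 1))"
      unfolding l(2) inner_sum_right by (rule sum.cong) (use a in auto)
    have "x - v \<in> span ((\<lambda>u. u - v) ` S)" if "a \<bullet> (x - v) = 0"
    proof -
      have z: "\<forall>u\<in>N. l u * (if u \<in> S then 0 else 1) = 0"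
        using that eq sum_nonneg_eq_0_iff[OF basis(1), of "\<lambda>u. l u * (if u \<in> S then 0 else 1)"] l(1)
        by auto
      have "l u *\<^sub>R (u - v) \<in> span ((\<lambda>u. u - v) ` S)" if "u \<in> N" for u
        using bspec[OF z that] by (cases "u \<in> S") (auto intro: span_scale span_base span_zero)
      then show ?thesis unfolding l(2) by (rule span_sum)
    qed
    then show ?thesis using l(1) eq by (auto intro!: sum_nonneg)
  qed
  have "span_face P v S = P \<inter> {x. a \<bullet> x = a \<bullet> v}"
    using coeff a0 by (fastforce simp: span_face_def inner_diff_right)
  moreover have "P \<inter> {x. a \<bullet> x = a \<bullet> v} face_of P"
    using P coeff by (intro face_of_Int_supporting_hyperplane_ge)
      (auto simp: simple_polytope_def polytope_imp_convex inner_diff_right)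
  ultimately show "span_face P v S face_of P" by simp
  show vF: "v \<in> span_face P v S" using vP by (simp add: span_face_def span_zero)
  have SF: "S \<subseteq> span_face P v S"
    using SN NP by (auto simp: span_face_def intro: span_base)
  moreover have "u \<in> S" if "u \<in> N" "u \<in> span_face P v S" for u
    using a[OF that(1)] a0[of "u - v"] that(2) by (auto simp: span_face_def split: if_splits)
  ultimately show "span_face P v S \<inter> {u. adjacent P u v} = S" using SN by (auto simp: N_def)
  have indep: "independent ((\<lambda>u. u - v) ` S)"
    using basis(3) SN by (meson image_mono independent_mono)
  have "aff_dim (span_face P v S) = int (dim ((\<lambda>x. - v + x) ` span_face P v S))"
    using aff_dim_eq_dim vF hull_inc by metis
  also have "dim ((\<lambda>x. - v + x) ` span_face P v S) = card ((\<lambda>u. u - v) ` S)"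
    using SF indep
    by (intro dim_unique) (auto simp: span_face_def image_iff)
  also have "\<dots> = card S" by (simp add: card_image inj_on_def)
  finally show "aff_dim (span_face P v S) = int (card S)" .
qed

text \<open>A face through \<open>v\<close> contains every neighbour that has a positive coefficient
  in one of its points; conversely it contains all points of \<open>P\<close> in its affine
  hull.\<close>

lemma face_of_eq_span_face:
  fixes P :: "'a::euclidean_space set"
  assumes P: "simple_polytope P" and v: "v \<in> vertices P"
    and F: "F face_of P" "v \<in> F"
  shows "F = span_face P v (F \<inter> {u. adjacent P u v})"
proof (intro equalityI subsetI)
  define N where "N = {u. adjacent P u v}"
  note basis = simple_vertex_basis[OF P v, folded N_def]
  have NP: "N \<subseteq> P" and vP: "v \<in> P"
    using v by (auto simp: N_def adjacent_def vertices_def extreme_point_of_def)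
  have convP: "convex P" using P by (simp add: simple_polytope_def polytope_imp_convex)
  {
    fix x assume xF: "x \<in> F"
    then have "x \<in> P" using F face_of_imp_subset by blast
    then obtain l where l: "\<forall>u\<in>N. 0 \<le> l u" "x - v = (\<Sum>u\<in>N. l u *\<^sub>R (u - v))"
      using basis(4) by blast
    have uF: "u \<in> F" if u: "u \<in> N" and "l u \<noteq> 0" for u
    proof (cases "u = v")
      case False
      have lu: "l u > 0" using l(1) that by force
      text \<open>Split off the direction of \<open>u\<close>: a point of \<open>F\<close> close to \<open>v\<close> lies strictly
        between \<open>u\<close> and another point of \<open>P\<close>.\<close>
      define s where "s = sum l N"
      have sl: "s \<ge> l u" unfolding s_def using l(1) u basis(1) by (intro member_le_sum) auto
      \<comment> \<open>Any \<open>e\<close> with \<open>0 < e\<close>, \<open>e <= 1\<close> and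
        \<open>e * s < 1\<close> would do: the coefficients of \<open>y - v\<close> then sum to less
        than 1, so the weight \<open>t\<close> of \<open>u\<close> can be split off.\<close>
      define e where "e = 1 / (2 * s + 1)"
      have e: "0 < e" "e \<le> 1" "e * s < 1" using lu sl by (auto simp: e_def field_simps)
      define y where "y = v + e *\<^sub>R (x - v)"
      have yF: "y \<in> F"
      proof -
        have "y = (1 - e) *\<^sub>R v + e *\<^sub>R x" by (simp add: y_def algebra_simps)
        then show ?thesis using face_of_imp_convex[OF F(1)] xF F(2) e
          by (simp add: convex_def)
      qed
      define t where "t = e * l u"
      have t: "0 < t" "t < 1"
        using e lu mult_left_mono[OF sl, of e] unfolding t_def by (simp, linarith)
      \<comment> \<open>\<open>z\<close> is the solution of
        \<open>y = (1 - t) *\<^sub>R z + t *\<^sub>R u\<close>.\<close>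
      define z where "z = v + (1 / (1 - t)) *\<^sub>R (y - v - t *\<^sub>R (u - v))"
      have vN: "v \<notin> N"
        by (auto simp: N_def adjacent_def edge_of_def)
      have z_eq: "z = v + (\<Sum>u'\<in>N - {u}. (e * l u' / (1 - t)) *\<^sub>R (u' - v))"
      proof -
        have "y - v - t *\<^sub>R (u - v) = (\<Sum>u'\<in>N - {u}. (e * l u') *\<^sub>R (u' - v))"
          using u basis(1)
          by (simp add: y_def l(2) sum.remove[of N u] t_def scaleR_add_right scaleR_sum_right)
        then show ?thesis by (simp add: z_def scaleR_sum_right)
      qed
      have zP: "z \<in> P"
      proof -
        \<comment> \<open>\<open>r\<close> is the weight of \<open>z\<close> on the remaining
          neighbours. It is at most 1, so giving \<open>1 - r\<close> to \<open>v\<close> makes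
          \<open>z\<close> a convex combination.\<close>
        define r where "r = (\<Sum>u'\<in>N - {u}. e * l u' / (1 - t))"
        have "r = (e * s - t) / (1 - t)"
          using u basis(1) by (simp add: r_def s_def t_def sum.remove[of N u] distrib_left
              flip: sum_divide_distrib sum_distrib_left)
        then have r1: "r \<le> 1" using e(3) t by (simp add: divide_le_eq)
        have "z = (1 - r) *\<^sub>R v + (\<Sum>u'\<in>N - {u}. (e * l u' / (1 - t)) *\<^sub>R u')"
          unfolding z_eq r_def
          by (simp add: scaleR_diff_right sum_subtractf scaleR_diff_left scaleR_sum_left)
        also have "\<dots> = (\<Sum>u'\<in>insert v (N - {u}).
            (if u' = v then 1 - r else e * l u' / (1 - t)) *\<^sub>R u')"
        proof -
          have "(\<Sum>u'\<in>N - {u}. (e * l u' / (1 - t)) *\<^sub>R u')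
              = (\<Sum>u'\<in>N - {u}. (if u' = v then 1 - r else e * l u' / (1 - t)) *\<^sub>R u')"
            by (rule sum.cong) (use vN in auto)
          then show ?thesis using basis(1) vN by simp
        qed
        also have "\<dots> \<in> P"
        proof (rule convex_sum[OF _ convP])
          show "finite (insert v (N - {u}))" using basis(1) by simp
          show "(\<Sum>u'\<in>insert v (N - {u}). if u' = v then 1 - r else e * l u' / (1 - t)) = 1"
          proof -
            have "(\<Sum>u'\<in>N - {u}. if u' = v then 1 - r else e * l u' / (1 - t)) = r"
              unfolding r_def by (rule sum.cong) (use vN in auto)
            then show ?thesis using basis(1) vN by simp
          qed
        qed (use r1 l(1) e t NP vP in auto)
        finally show ?thesis .
      qed
      have y_eq: "y = (1 - t) *\<^sub>R z + t *\<^sub>R u"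
      proof -
        have "(1 - t) *\<^sub>R z = (1 - t) *\<^sub>R v + (y - v - t *\<^sub>R (u - v))"
          using t by (simp add: z_def scaleR_add_right)
        then show ?thesis by (simp add: algebra_simps)
      qed
      show ?thesis
      proof (cases "z = u")
        case True
        then have "y = u" using y_eq by (simp add: algebra_simps)
        then show ?thesis using yF by simp
      next
        case False
        then have "y \<in> open_segment z u"
          using t y_eq unfolding in_segment by blast
        then show ?thesis using F(1) zP u NP yF unfolding face_of_def by blast
      qed
    qed (use F in simp)
    have "l u *\<^sub>R (u - v) \<in> span ((\<lambda>u. u - v) ` (F \<inter> N))" if "u \<in> N" for u
      using uF[OF that] that by (cases "l u = 0") (auto intro: span_scale span_base span_zero)
    then have "x - v \<in> span ((\<lambda>u. u - v) ` (F \<inter> N))" unfolding l(2) by (rule span_sum)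
    then show "x \<in> span_face P v (F \<inter> {u. adjacent P u v})"
      using \<open>x \<in> P\<close> by (simp add: span_face_def N_def)
  }
  \<comment> \<open>For the converse, a face of a convex set is the intersection of that set with
    the affine hull of the face.\<close>
  fix x assume x: "x \<in> span_face P v (F \<inter> {u. adjacent P u v})"
  have "span ((\<lambda>u. u - v) ` (F \<inter> N)) \<subseteq> span ((\<lambda>u. u - v) ` F)"
    by (intro span_mono) auto
  then have "x - v \<in> span ((\<lambda>u. u - v) ` F)"
    using x by (auto simp: span_face_def N_def)
  then have "x \<in> affine hull F"
    using F(2) affine_hull_span_gen[of v F]
    by (simp add: hull_inc image_iff) (metis add.commute diff_add_cancel)
  moreover have "x \<in> P" using x by (simp add: span_face_def)
  ultimately show "x \<in> F" using F(1) convP face_of_imp_eq_affine_Int[of P F] by blast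
qed


section \<open>Faces and their top vertices\<close>

text \<open>\<open>Nb P (- c) v\<close> consists of the lower neighbours. The displacement
  \<open>x - v\<close> is a nonzero, nonnegative combination of directions along which
  \<open>c\<close> decreases.\<close>

lemma less_at_top_of_span_face:
  fixes P :: "'a::euclidean_space set"
  assumes P: "simple_polytope P" and v: "v \<in> vertices P"
    and S: "S \<subseteq> Nb P (- c) v" and x: "x \<in> span_face P v S" "x \<noteq> v"
  shows "c \<bullet> x < c \<bullet> v"
proof -
  have SN: "S \<subseteq> {u. adjacent P u v}" using S by (auto simp: Nb_def)
  obtain l where l: "\<And>u. u \<in> S \<Longrightarrow> 0 \<le> l u" "x - v = (\<Sum>u\<in>S. l u *\<^sub>R (u - v))"
    using span_face_coeffs[OF P v SN x(1)] by blast
  have finS: "finite S" using SN simple_vertex_basis(1)[OF P v] finite_subset by blast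
  have neg: "c \<bullet> (u - v) < 0" if "u \<in> S" for u
    using S that by (auto simp: Nb_def inner_diff_right)
  obtain u where u: "u \<in> S" "l u \<noteq> 0"
    using l(2) x(2) by (metis (no_types, lifting) eq_iff_diff_eq_0 scaleR_eq_0_iff sum.neutral)
  have "(\<Sum>u\<in>S. l u * (c \<bullet> (u - v))) < (\<Sum>u\<in>S. 0)"
  proof (rule sum_strict_mono_ex1[OF finS])
    show "\<forall>u\<in>S. l u * (c \<bullet> (u - v)) \<le> 0"
      using l(1) neg by (simp add: mult_nonneg_nonpos less_imp_le)
    show "\<exists>u\<in>S. l u * (c \<bullet> (u - v)) < 0"
      using u l(1)[OF u(1)] neg[OF u(1)] by (intro bexI[of _ u] mult_pos_neg) auto
  qed
  then have "c \<bullet> (x - v) < 0" unfolding l(2) by (simp add: inner_sum_right)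
  then show ?thesis by (simp add: inner_diff_right)
qed

lemma finite_vertices: "polytope P \<Longrightarrow> finite (vertices P)"
  by (simp add: vertices_def finite_polyhedron_extreme_points polytope_imp_polyhedron)

text \<open>A nonempty face has a highest vertex \<open>v\<close>; the neighbours of
  \<open>v\<close> in the face lie below \<open>v\<close> and determine the face. Two different tops
  of one face would each be strictly above the other.\<close>

lemma bij_betw_span_face:
  fixes P :: "'a::euclidean_space set"
  assumes P: "simple_polytope P" and c: "generic P c"
  shows "bij_betw (\<lambda>(v, S). span_face P v S) (SIGMA v:vertices P. Pow (Nb P (- c) v))
    {F. F face_of P \<and> F \<noteq> {}}"
proof (rule bij_betw_imageI)
  have poly: "polytope P" using P by (simp add: simple_polytope_def)
  have Nb_adj: "Nb P (- c) v \<subseteq> {u. adjacent P u v}" for v by (auto simp: Nb_def)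
  show "inj_on (\<lambda>(v, S). span_face P v S) (SIGMA v:vertices P. Pow (Nb P (- c) v))"
  proof (rule inj_onI, clarsimp)
    fix v S v' S'
    assume v: "v \<in> vertices P" "S \<subseteq> Nb P (- c) v" and v': "v' \<in> vertices P" "S' \<subseteq> Nb P (- c) v'"
      and eq: "span_face P v S = span_face P v' S'"
    note adj = v(2)[THEN order_trans, OF Nb_adj] v'(2)[THEN order_trans, OF Nb_adj]
    have "v \<in> span_face P v' S'" "v' \<in> span_face P v S"
      using span_face_face_of(2)[OF P v(1) adj(1)] span_face_face_of(2)[OF P v'(1) adj(2)] eq
      by auto
    then have vv: "v = v'"
      using less_at_top_of_span_face[OF P v, of v'] less_at_top_of_span_face[OF P v', of v]
      by (metis order_less_asym)
    have "span_face P v S \<inter> {u. adjacent P u v} = span_face P v' S' \<inter> {u. adjacent P u v'}"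
      unfolding eq unfolding vv ..
    then show "v = v' \<and> S = S'"
      using vv span_face_face_of(3)[OF P v(1) adj(1)] span_face_face_of(3)[OF P v'(1) adj(2)]
      by metis
  qed
  show "(\<lambda>(v, S). span_face P v S) ` (SIGMA v:vertices P. Pow (Nb P (- c) v))
      = {F. F face_of P \<and> F \<noteq> {}}" (is "?L = ?R")
  proof (intro equalityI subsetI)
    fix F assume "F \<in> ?L"
    then obtain v S where v: "v \<in> vertices P" and S: "S \<subseteq> Nb P (- c) v"
      and F: "F = span_face P v S" by auto
    then show "F \<in> ?R"
      using span_face_face_of(1,2)[OF P v S[THEN order_trans, OF Nb_adj]] by auto
  next
    fix F assume "F \<in> ?R"
    then have F: "F face_of P" "F \<noteq> {}" by auto
    have "compact F" "convex F"
      using F poly face_of_imp_compact face_of_imp_convex polytope_imp_compact polytope_imp_convex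
      by blast+
    \<comment> \<open>An extreme point of the face is a vertex of \<open>P\<close>, so the maximum
      that follows is over a nonempty set.\<close>
    then obtain z where "z extreme_point_of F"
      using extreme_point_exists_convex F(2) by blast
    then have z: "z \<in> vertices P \<inter> F"
      using extreme_point_of_face[OF F(1)] by (simp add: vertices_def)
    have "finite (vertices P \<inter> F)" using finite_vertices[OF poly] by simp
    then obtain v where v: "v \<in> vertices P \<inter> F" and max: "\<And>u. u \<in> vertices P \<inter> F \<Longrightarrow> c \<bullet> u \<le> c \<bullet> v"
      using z obtains_MAX[of "vertices P \<inter> F" "\<lambda>u. c \<bullet> u"]
      by (metis (no_types, lifting) Max_ge emptyE finite_imageI imageI)
    define S where "S = F \<inter> {u. adjacent P u v}"
    have "S \<subseteq> Nb P (- c) v"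
      unfolding S_def
    proof clarify
      fix u assume u: "u \<in> F" "adjacent P u v"
      then have "c \<bullet> u \<le> c \<bullet> v" using max[of u] by (simp add: adjacent_def)
      moreover have "c \<bullet> u \<noteq> c \<bullet> v" using u c by (simp add: generic_def)
      ultimately show "u \<in> Nb P (- c) v" using u by (simp add: Nb_def)
    qed
    moreover have "F = span_face P v S"
      unfolding S_def using v by (intro face_of_eq_span_face[OF P _ F(1)]) auto
    ultimately show "F \<in> ?L" using v by (intro image_eqI[of _ _ "(v, S)"]) simp_all
  qed
qed

section \<open>Counting faces by dimension and the symmetry of the h-vector\<close>

text \<open>Faces are grouped by top vertex: a vertex with \<open>k\<close> lower neighbours is the
  top of \<open>k choose i\<close> faces of dimension \<open>i\<close>. This is the relation f(x) =
  h(x + 1) between the face polynomial and the h-polynomial.\<close>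

lemma sum_faces_eq_sum_vertices:
  fixes P :: "'a::euclidean_space set" and x :: real
  assumes P: "simple_polytope P" and c: "generic P c"
  shows "(\<Sum>F | F face_of P \<and> F \<noteq> {}. x ^ nat (aff_dim F))
    = (\<Sum>v\<in>vertices P. (x + 1) ^ card (Nb P (- c) v))"
proof -
  have finV: "finite (vertices P)" using P by (simp add: finite_vertices simple_polytope_def)
  have sub: "Nb P (- c) v \<subseteq> {u. adjacent P u v}" for v by (auto simp: Nb_def)
  have finNb: "finite (Nb P (- c) v)" if "v \<in> vertices P" for v
    using simple_vertex_basis(1)[OF P that] sub finite_subset by blast
  have "(\<Sum>F | F face_of P \<and> F \<noteq> {}. x ^ nat (aff_dim F))
      = (\<Sum>(v, S)\<in>(SIGMA v:vertices P. Pow (Nb P (- c) v)). x ^ nat (aff_dim (span_face P v S)))"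
    by (subst sum.reindex_bij_betw[OF bij_betw_span_face[OF P c], symmetric]) (simp add: case_prod_unfold)
  also have "\<dots> = (\<Sum>v\<in>vertices P. \<Sum>S\<in>Pow (Nb P (- c) v). x ^ nat (aff_dim (span_face P v S)))"
    by (rule sum.Sigma[symmetric]) (use finV finNb in auto)
  also have "\<dots> = (\<Sum>v\<in>vertices P. \<Sum>S\<in>Pow (Nb P (- c) v). x ^ card S)"
    using span_face_face_of(4)[OF P] sub
    by (intro sum.cong refl) (metis PowD order_trans nat_int)
  also have "\<dots> = (\<Sum>v\<in>vertices P. (x + 1) ^ card (Nb P (- c) v))"
  proof (rule sum.cong[OF refl])
    fix v assume v: "v \<in> vertices P"
    \<comment> \<open>The binomial theorem, by expanding a product of factors \<open>x + 1\<close>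
      over subsets.\<close>
    show "(\<Sum>S\<in>Pow (Nb P (- c) v). x ^ card S) = (x + 1) ^ card (Nb P (- c) v)"
      using prod_add[OF finNb[OF v], of "\<lambda>_. x" "\<lambda>_. 1"] by simp
  qed
  finally show ?thesis .
qed

text \<open>Both sums are polynomials in \<open>x\<close>, and the cardinalities are their
  coefficients.\<close>

lemma sum_power_eq_imp_card_eq:
  fixes f g :: "'b \<Rightarrow> nat"
  assumes fin: "finite V" and eq: "\<And>x::real. (\<Sum>v\<in>V. x ^ f v) = (\<Sum>v\<in>V. x ^ g v)"
  shows "card {v \<in> V. f v = i} = card {v \<in> V. g v = i}"
proof -
  obtain n where n: "\<forall>v\<in>V. f v \<le> n \<and> g v \<le> n" "i \<le> n"
  proof
    show "\<forall>v\<in>V. f v \<le> sum f V + sum g V + i \<and> g v \<le> sum f V + sum g V + i"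
      using fin member_le_sum[of _ V f] member_le_sum[of _ V g] by (auto simp: trans_le_add1 trans_le_add2)
  qed simp
  have expand: "(\<Sum>v\<in>V. x ^ h v) = (\<Sum>j\<le>n. real (card {v \<in> V. h v = j}) * x ^ j)"
    if "\<forall>v\<in>V. h v \<le> n" for h :: "'b \<Rightarrow> nat" and x :: real
  proof -
    have "(\<Sum>v\<in>V. x ^ h v) = (\<Sum>j\<le>n. \<Sum>v | v \<in> V \<and> h v = j. x ^ h v)"
      using that by (intro sum.group[symmetric] fin) auto
    then show ?thesis by simp
  qed
  have "\<forall>x. (\<Sum>j\<le>n. real (card {v \<in> V. f v = j}) * x ^ j)
      = (\<Sum>j\<le>n. real (card {v \<in> V. g v = j}) * x ^ j)"
    using eq expand[of f] expand[of g] n by simp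
  then show ?thesis using n(2) unfolding polyfun_eq_coeffs by simp
qed

text \<open>The face count does not involve \<open>c\<close>, and replacing \<open>c\<close> by
  \<open>- c\<close> exchanges lower and upper neighbours.\<close>

lemma dehn_sommerville:
  fixes P :: "'a::euclidean_space set"
  assumes P: "simple_polytope P" and c: "generic P c"
  shows "h_vector P c i = card {v \<in> vertices P. card (Nb P c v) = i}"
proof -
  have finV: "finite (vertices P)" using P by (simp add: finite_vertices simple_polytope_def)
  have c': "generic P (- c)" using c by (simp add: generic_def)
  \<comment> \<open>Evaluating the face count at \<open>x - 1\<close> turns the base
    \<open>x + 1\<close> into \<open>x\<close>.\<close>
  have "(\<Sum>v\<in>vertices P. x ^ card (Nb P (- c) v)) = (\<Sum>v\<in>vertices P. x ^ card (Nb P c v))"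
    for x :: real
    using sum_faces_eq_sum_vertices[OF P c, of "x - 1"] sum_faces_eq_sum_vertices[OF P c', of "x - 1"]
    by simp
  then have "card {v \<in> vertices P. card (Nb P (- c) v) = i} = card {v \<in> vertices P. card (Nb P c v) = i}"
    by (rule sum_power_eq_imp_card_eq[OF finV])
  then show ?thesis by (simp add: h_vector_def in_degree_def Nb_def)
qed

section \<open>Sinks, out-degrees and the number of facets\<close>

text \<open>A local maximum is global: if \<open>v\<close> has no upper neighbours, \<open>P\<close>
  itself is the face spanned by the lower neighbours of \<open>v\<close>, so \<open>v\<close> is its
  strict maximum.\<close>

lemma sink_iff_v_opt:
  fixes P :: "'a::euclidean_space set"
  assumes P: "simple_polytope P" and c: "generic P c"
  shows "v_opt P c \<in> vertices P"
    and "v \<in> vertices P \<Longrightarrow> Nb P c v = {} \<longleftrightarrow> v = v_opt P c"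
proof -
  have finV: "finite (vertices P)" using P by (simp add: finite_vertices simple_polytope_def)
  have VP: "vertices P \<subseteq> P" by (auto simp: vertices_def extreme_point_of_def)
  have convP: "convex P" using P by (simp add: simple_polytope_def polytope_imp_convex)
  have "P \<noteq> {}" using P by (auto simp: simple_polytope_def)
  then obtain z where "z \<in> vertices P"
    using extreme_point_exists_convex[of P] P polytope_imp_compact convP
    by (auto simp: vertices_def simple_polytope_def)
  then obtain o' where o': "o' \<in> vertices P" and max: "\<And>u. u \<in> vertices P \<Longrightarrow> c \<bullet> u \<le> c \<bullet> o'"
    using finV obtains_MAX[of "vertices P" "\<lambda>u. c \<bullet> u"]
    by (metis (no_types, lifting) Max_ge emptyE finite_imageI imageI)
  have sink: "v = v_opt P c" if v: "v \<in> vertices P" "Nb P c v = {}" for v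
  proof -
    have "P \<inter> {u. adjacent P u v} \<subseteq> Nb P (- c) v"
      using v(2) c by (force simp: Nb_def generic_def)
    moreover have "P = span_face P v (P \<inter> {u. adjacent P u v})"
      using face_of_eq_span_face[OF P v(1) face_of_refl[OF convP]] v(1) VP by blast
    ultimately have less: "c \<bullet> x < c \<bullet> v" if "x \<in> P" "x \<noteq> v" for x
      using less_at_top_of_span_face[OF P v(1)] that by blast
    have "v_opt P c = v"
      unfolding v_opt_def
    proof (rule the_equality)
      show "v \<in> vertices P \<and> (\<forall>u\<in>vertices P. c \<bullet> u \<le> c \<bullet> v)"
        using v(1) less VP by (metis less_le_not_le order_refl subsetD)
      show "u = v" if "u \<in> vertices P \<and> (\<forall>w\<in>vertices P. c \<bullet> w \<le> c \<bullet> u)" for u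
        using that less[of u] v(1) VP by (meson not_le subsetD)
    qed
    then show ?thesis by simp
  qed
  have "Nb P c o' = {}"
    using max by (force simp: Nb_def adjacent_def)
  then have "o' = v_opt P c" using sink o' by blast
  then show "v_opt P c \<in> vertices P" "v \<in> vertices P \<Longrightarrow> Nb P c v = {} \<longleftrightarrow> v = v_opt P c"
    using o' sink \<open>Nb P c o' = {}\<close> by auto
qed

lemma card_Nb_minus:
  fixes P :: "'a::euclidean_space set"
  assumes P: "simple_polytope P" and c: "generic P c" and v: "v \<in> vertices P"
  shows "card (Nb P (- c) v) + card (Nb P c v) = DIM('a)" and "finite (Nb P c v)"
proof -
  have eq: "{u. adjacent P u v} = Nb P (- c) v \<union> Nb P c v"
    using c by (force simp: Nb_def generic_def)
  then have "finite (Nb P (- c) v \<union> Nb P c v)" using simple_vertex_basis(1)[OF P v] by simp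
  moreover have "Nb P (- c) v \<inter> Nb P c v = {}" by (auto simp: Nb_def)
  ultimately show "card (Nb P (- c) v) + card (Nb P c v) = DIM('a)" "finite (Nb P c v)"
    using simple_vertex_basis(2)[OF P v] unfolding eq by (auto simp: card_Un_disjoint)
qed

text \<open>Facets correspond to a vertex with \<open>DIM('a) - 1\<close> of its lower neighbours.
  The optimum is the top of \<open>DIM('a)\<close> of them, and each vertex of out-degree 1 is the
  top of exactly one.\<close>

lemma card_facets_ge:
  fixes P :: "'a::euclidean_space set"
  assumes P: "simple_polytope P" and c: "generic P c"
  shows "DIM('a) + card {v \<in> vertices P. card (Nb P c v) = 1} \<le> card {F. F facet_of P}"
proof -
  define W where "W = {v \<in> vertices P. card (Nb P c v) = 1}"
  define D where "D v = {S. S \<subseteq> Nb P (- c) v \<and> card S = DIM('a) - 1}" for v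
  have finV: "finite (vertices P)" and poly: "polytope P" and dimP: "aff_dim P = int DIM('a)"
    using P by (auto simp: finite_vertices simple_polytope_def)
  have c': "generic P (- c)" using c by (simp add: generic_def)
  note opt = sink_iff_v_opt[OF P c]
  have finNb: "finite (Nb P (- c) v)" if "v \<in> vertices P" for v
    using card_Nb_minus(2)[OF P c' that] by simp
  have cardD: "card (D v) = card (Nb P (- c) v) choose (DIM('a) - 1)" if "v \<in> vertices P" for v
    unfolding D_def using finNb[OF that] by (rule n_subsets)
  have finD: "finite (D v)" if "v \<in> vertices P" for v
    unfolding D_def using finNb[OF that] by simp
  have optW: "v_opt P c \<notin> W"
    using opt(2)[OF opt(1)] by (simp add: W_def)
  have finW: "finite W" using finV by (simp add: W_def)
  have WV: "insert (v_opt P c) W \<subseteq> vertices P" using opt by (auto simp: W_def)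
  have cardW: "card (D v) = 1" if "v \<in> W" for v
  proof -
    have v: "v \<in> vertices P" "card (Nb P c v) = 1" using that by (auto simp: W_def)
    then have "card (Nb P (- c) v) = DIM('a) - 1" using card_Nb_minus(1)[OF P c v(1)] by linarith
    then show ?thesis by (simp add: cardD[OF v(1)])
  qed
  have "Nb P c (v_opt P c) = {}" using opt by simp
  then have "card (Nb P (- c) (v_opt P c)) = DIM('a)"
    using card_Nb_minus(1)[OF P c opt(1)] by simp
  then have "card (D (v_opt P c)) = DIM('a)"
    using cardD[OF opt(1)] binomial_symmetric[of "DIM('a) - 1" "DIM('a)"] DIM_positive[where 'a='a]
    by simp
  then have "DIM('a) + card W = (\<Sum>v\<in>insert (v_opt P c) W. card (D v))"
    using cardW optW finW by simp
  also have "\<dots> \<le> (\<Sum>v\<in>vertices P. card (D v))"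
    using WV finV by (intro sum_mono2) auto
  also have "\<dots> = card (SIGMA v:vertices P. D v)"
    using finV finD by simp
  also have "\<dots> \<le> card {F. F facet_of P}"
  proof (rule card_inj_on_le)
    have sub: "(SIGMA v:vertices P. D v) \<subseteq> (SIGMA v:vertices P. Pow (Nb P (- c) v))"
      by (auto simp: D_def)
    show "inj_on (\<lambda>(v, S). span_face P v S) (SIGMA v:vertices P. D v)"
      using bij_betw_imp_inj_on[OF bij_betw_span_face[OF P c]] sub by (rule inj_on_subset)
    show "(\<lambda>(v, S). span_face P v S) ` (SIGMA v:vertices P. D v) \<subseteq> {F. F facet_of P}"
    proof clarify
      fix v S assume v: "v \<in> vertices P" and S: "S \<in> D v"
      then have "S \<subseteq> {u. adjacent P u v}" by (auto simp: D_def Nb_def)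
      note span_face_face_of[OF P v this]
      \<comment> \<open>Positivity of the dimension makes the natural-number difference
        \<open>DIM('a) - 1\<close> a true codimension 1.\<close>
      then show "span_face P v S facet_of P"
        using S dimP DIM_positive[where 'a='a] by (auto simp: facet_of_def D_def of_nat_diff)
    qed
    show "finite {F. F facet_of P}"
      using finite_polytope_faces[OF poly] by (rule rev_finite_subset) (auto simp: facet_of_def)
  qed
  finally show ?thesis by (simp add: W_def)
qed

section \<open>Incoherent arborescences\<close>

text \<open>More than \<open>DIM('a)\<close> distinct vectors are dependent. A repeated vector would
  shrink the image set, so in that case the relation is the difference of two equal members.\<close>

lemma nontrivial_relation:
  fixes a :: "'b \<Rightarrow> 'a::euclidean_space"
  assumes fin: "finite B" and card: "DIM('a) < card B"
  obtains l where "\<exists>v\<in>B. l v \<noteq> 0" "(\<Sum>v\<in>B. l v *\<^sub>R a v) = 0"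
proof (cases "inj_on a B")
  case True
  then have "dependent (a ` B)"
    using card by (intro dependent_biggerset) (simp add: fin card_image)
  then obtain k where "\<exists>x\<in>a ` B. k x \<noteq> 0" "(\<Sum>x\<in>a ` B. k x *\<^sub>R x) = 0"
    using fin by (auto simp: dependent_finite)
  then show ?thesis using that[of "k \<circ> a"] True by (auto simp: sum.reindex)
next
  case False
  then obtain p q where pq: "p \<in> B" "q \<in> B" "p \<noteq> q" "a p = a q" by (auto simp: inj_on_def)
  define l :: "'b \<Rightarrow> real" where "l v = (if v = p then 1 else if v = q then - 1 else 0)" for v
  have "(\<Sum>v\<in>B. l v *\<^sub>R a v) = (\<Sum>v\<in>{p, q}. l v *\<^sub>R a v)"
    using pq fin by (intro sum.mono_neutral_right) (auto simp: l_def)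
  also have "\<dots> = 0" using pq by (simp add: l_def)
  finally have "(\<Sum>v\<in>B. l v *\<^sub>R a v) = 0" .
  moreover have "\<exists>v\<in>B. l v \<noteq> 0" using pq(1) by (intro bexI[of _ p]) (simp_all add: l_def)
  ultimately show ?thesis by (rule that[rotated])
qed

text \<open>The product is the set of all arborescences: each vertex freely picks an upper
  neighbour, and a one-element factor fixes the optimum.\<close>

lemma coherent_arborescences_subset:
  fixes P :: "'a::euclidean_space set"
  assumes "v_opt P c \<in> vertices P"
  shows "coherent_arborescences P c \<eta>
    \<subseteq> (\<Pi>\<^sub>E v\<in>vertices P. if v = v_opt P c then {v} else Nb P c v)"
  by (auto simp: coherent_arborescences_def PiE_iff extensional_def)

lemma card_arborescences:
  fixes P :: "'a::euclidean_space set"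
  assumes "finite (vertices P)" "v_opt P c \<in> vertices P"
  shows "card (\<Pi>\<^sub>E v\<in>vertices P. if v = v_opt P c then {v} else Nb P c v)
    = (\<Prod>v\<in>vertices P - {v_opt P c}. card (Nb P c v))"
proof -
  have "card (\<Pi>\<^sub>E v\<in>vertices P. if v = v_opt P c then {v} else Nb P c v)
      = (\<Prod>v\<in>vertices P. if v = v_opt P c then 1 else card (Nb P c v))"
    unfolding card_PiE[OF assms(1)] by (rule prod.cong) auto
  also have "\<dots> = (\<Prod>v\<in>vertices P - {v_opt P c}. card (Nb P c v))"
    unfolding prod.remove[OF assms] by (simp cong: prod.cong_simp)
  finally show ?thesis .
qed

text \<open>Grouping by out-degree gives the exponents, which \<open>dehn_sommerville\<close>
  identifies with the h-vector defined through in-degrees.\<close>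

lemma prod_card_Nb:
  fixes P :: "'a::euclidean_space set"
  assumes P: "simple_polytope P" and c: "generic P c"
  shows "(\<Prod>v\<in>vertices P - {v_opt P c}. card (Nb P c v)) = (\<Prod>i = 1..DIM('a). i ^ h_vector P c i)"
proof -
  have finV: "finite (vertices P)" using P by (simp add: finite_vertices simple_polytope_def)
  note opt = sink_iff_v_opt[OF P c]
  let ?W = "\<lambda>i. {v. v \<in> vertices P - {v_opt P c} \<and> card (Nb P c v) = i}"
  have "1 \<le> card (Nb P c v) \<and> card (Nb P c v) \<le> DIM('a)" if "v \<in> vertices P - {v_opt P c}" for v
    using that opt(2)[of v] card_Nb_minus[OF P c, of v] by (auto simp: Suc_le_eq card_gt_0_iff)
  then have "(\<Prod>v\<in>vertices P - {v_opt P c}. card (Nb P c v))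
      = (\<Prod>i = 1..DIM('a). \<Prod>v\<in>?W i. card (Nb P c v))"
    using finV by (intro prod.group[symmetric] image_subsetI) simp_all
  also have "\<dots> = (\<Prod>i = 1..DIM('a). i ^ h_vector P c i)"
  proof (rule prod.cong[OF refl])
    fix i assume "i \<in> {1..DIM('a)}"
    \<comment> \<open>The optimum has out-degree 0, so leaving it out does not change the classes
      with \<open>i >= 1\<close>.\<close>
    moreover have "Nb P c (v_opt P c) = {}" using opt by simp
    ultimately have "?W i = {v \<in> vertices P. card (Nb P c v) = i}" by auto
    then show "(\<Prod>v\<in>?W i. card (Nb P c v)) = i ^ h_vector P c i"
      unfolding dehn_sommerville[OF P c] by simp
  qed
  finally show ?thesis .
qed

text \<open>Vertices with two upper neighbours carry binary choices. On \<open>DIM('a) + 1\<close>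
  of them a linear relation rules out two patterns, and every choice at the others extends each
  pattern to an incoherent arborescence.\<close>

lemma card_coherent_arborescences_le:
  fixes P :: "'a::euclidean_space set"
  assumes P: "simple_polytope P" and c: "generic P c"
    and large: "DIM('a) < card {v \<in> vertices P. 2 \<le> card (Nb P c v)}"
  shows "card (coherent_arborescences P c \<eta>)
      + 2 * 2 ^ (card {v \<in> vertices P. 2 \<le> card (Nb P c v)} - (DIM('a) + 1))
    \<le> (\<Prod>v\<in>vertices P - {v_opt P c}. card (Nb P c v))"
proof -
  define V where "V = vertices P"
  define opt where "opt = v_opt P c"
  define B where "B = {v \<in> V. 2 \<le> card (Nb P c v)}"
  define Arb where "Arb = (\<Pi>\<^sub>E v\<in>V. if v = opt then {v} else Nb P c v)"
  define coh where "coh = coherent_arborescences P c \<eta>"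
  have finV: "finite V" using P by (simp add: V_def finite_vertices simple_polytope_def)
  have optV: "opt \<in> V" and sink: "\<And>v. v \<in> V \<Longrightarrow> Nb P c v = {} \<longleftrightarrow> v = opt"
    using sink_iff_v_opt[OF P c] by (auto simp: V_def opt_def)
  have finNb: "finite (Nb P c v)" if "v \<in> V" for v
    using card_Nb_minus(2)[OF P c] that by (simp add: V_def)
  have cohArb: "coh \<subseteq> Arb"
    using coherent_arborescences_subset[of P c \<eta>] optV by (simp add: coh_def Arb_def V_def opt_def)
  have cardArb: "card Arb = (\<Prod>v\<in>V - {opt}. card (Nb P c v))"
    using card_arborescences[of P c] finV optV by (simp add: Arb_def V_def opt_def)
  have finArb: "finite Arb"
    unfolding Arb_def using finV finNb by (intro finite_PiE) auto
  have finB: "finite B" using finV by (simp add: B_def)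
  have optB: "opt \<notin> B" using sink[OF optV] by (auto simp: B_def)
  \<comment> \<open>One vertex more than the dimension forces a relation among the vectors attached
    to \<open>B'\<close>.\<close>
  obtain B' where B': "B' \<subseteq> B" "card B' = DIM('a) + 1" "finite B'"
    using large obtain_subset_with_card_n[of "DIM('a) + 1" B] by (auto simp: B_def V_def)
  have "\<forall>v\<in>B. \<exists>p q. p \<in> Nb P c v \<and> q \<in> Nb P c v \<and> p \<noteq> q"
  proof
    fix v assume "v \<in> B"
    then have "2 \<le> card (Nb P c v)" by (simp add: B_def)
    then obtain T where "T \<subseteq> Nb P c v" "card T = 2" using obtain_subset_with_card_n by metis
    then show "\<exists>p q. p \<in> Nb P c v \<and> q \<in> Nb P c v \<and> p \<noteq> q" by (auto simp: card_2_iff)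
  qed
  from bchoice[OF this] obtain p
    where "\<forall>v\<in>B. \<exists>q. p v \<in> Nb P c v \<and> q \<in> Nb P c v \<and> p v \<noteq> q" by blast
  from bchoice[OF this] obtain q
    where pq: "\<And>v. v \<in> B \<Longrightarrow> p v \<in> Nb P c v \<and> q v \<in> Nb P c v \<and> p v \<noteq> q v" by blast
  \<comment> \<open>Outside \<open>B\<close> a fixed upper neighbour suffices, as only the choices
    on \<open>B\<close> are counted.\<close>
  define r where "r v = (SOME u. u \<in> Nb P c v)" for v
  have r: "r v \<in> Nb P c v" if "v \<in> V - {opt}" for v
    using sink that by (simp add: r_def some_in_eq)
  \<comment> \<open>\<open>w \<bullet> slope u v\<close> is the quantity that coherence maximizes,
    so comparing \<open>p v\<close> with \<open>q v\<close> is linear in \<open>w\<close>.\<close>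
  define slope where "slope u v = (1 / \<eta> (u - v)) *\<^sub>R (u - v)" for u v
  obtain l where l: "\<exists>v\<in>B'. l v \<noteq> 0"
    and rel: "(\<Sum>v\<in>B'. l v *\<^sub>R (slope (p v) v - slope (q v) v)) = 0"
    using nontrivial_relation[OF B'(3), of "\<lambda>v. slope (p v) v - slope (q v) v"] B'(2) by auto
  text \<open>A choice between \<open>p\<close> and \<open>q\<close> that follows the signs of a linear relation, or their
    opposites, pairs a positive combination of positive numbers to \<open>0\<close>, so it is never coherent.\<close>
  define pos where "pos = {v \<in> B'. l v > 0}"
  define neg where "neg = {v \<in> B'. l v < 0}"
  \<comment> \<open>\<open>Y\<close> is the set of vertices of \<open>B\<close> that take
    \<open>p\<close>; the others in \<open>B\<close> take \<open>q\<close>.\<close>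
  define A where "A Y = (\<lambda>v\<in>V. if v = opt then opt else if v \<in> B then if v \<in> Y then p v else q v else r v)"
    for Y
  \<comment> \<open>In both patterns the vertices of \<open>B'\<close> with coefficient 0 take
    \<open>q\<close>; their terms drop out of the relation. On \<open>B - B'\<close> the choice is
    free.\<close>
  define bad where "bad = (\<lambda>X. X \<union> pos) ` Pow (B - B') \<union> (\<lambda>X. X \<union> neg) ` Pow (B - B')"
  have sub: "pos \<subseteq> B'" "neg \<subseteq> B'" by (auto simp: pos_def neg_def)
  \<comment> \<open>A nonzero coefficient separates \<open>pos\<close> from \<open>neg\<close>,
    which keeps the two families of bad choices disjoint.\<close>
  obtain v0 where v0: "v0 \<in> B'" "l v0 \<noteq> 0" using l by blast
  then have "v0 \<in> pos \<longleftrightarrow> v0 \<notin> neg" by (auto simp: pos_def neg_def)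
  then have ne: "pos \<noteq> neg" by blast
  have bad_B': "Y \<inter> B' = pos \<or> Y \<inter> B' = neg" "Y \<subseteq> B" if "Y \<in> bad" for Y
    using that sub B'(1) by (auto simp: bad_def)
  have cardbad: "card bad = 2 * 2 ^ (card B - (DIM('a) + 1))"
  proof -
    have "inj_on (\<lambda>X. X \<union> pos) (Pow (B - B'))" "inj_on (\<lambda>X. X \<union> neg) (Pow (B - B'))"
      using sub by (auto simp: inj_on_def)
    moreover have "(\<lambda>X. X \<union> pos) ` Pow (B - B') \<inter> (\<lambda>X. X \<union> neg) ` Pow (B - B') = {}"
    proof -
      have "X \<union> pos \<noteq> Y \<union> neg" if "X \<subseteq> B - B'" "Y \<subseteq> B - B'" for X Y
      proof
        assume "X \<union> pos = Y \<union> neg"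
        then have "(X \<union> pos) \<inter> B' = (Y \<union> neg) \<inter> B'" by simp
        then show False using that sub ne by blast
      qed
      then show ?thesis by blast
    qed
    ultimately have "card bad = 2 * 2 ^ card (B - B')"
      unfolding bad_def using finB by (simp add: card_Un_disjoint card_image card_Pow)
    then show ?thesis using B' finB by (simp add: card_Diff_subset)
  qed
  have injA: "inj_on A bad"
  proof (rule inj_onI)
    fix X Y assume X: "X \<in> bad" and Y: "Y \<in> bad" and eq: "A X = A Y"
    have "v \<in> X \<longleftrightarrow> v \<in> Y" if v: "v \<in> B" for v
    proof -
      have "A X v = A Y v" using eq by simp
      moreover have "v \<in> V" "v \<noteq> opt" using v optB by (auto simp: B_def)
      ultimately show ?thesis using v pq[OF v] by (auto simp: A_def split: if_splits)
    qed
    then show "X = Y" using bad_B'(2)[OF X] bad_B'(2)[OF Y] by blast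
  qed
  have "A Y \<in> Arb" for Y
    using pq r by (auto simp: A_def Arb_def)
  moreover have "A Y \<notin> coh" if Y: "Y \<in> bad" for Y
  proof
    assume "A Y \<in> coh"
    then obtain w where w: "\<And>v u. v \<in> V - {opt} \<Longrightarrow> u \<in> Nb P c v - {A Y v} \<Longrightarrow>
        (w \<bullet> (u - v)) / \<eta> (u - v) < (w \<bullet> (A Y v - v)) / \<eta> (A Y v - v)"
      unfolding coh_def coherent_arborescences_def V_def opt_def by blast
    \<comment> \<open>Coherence makes the sign of \<open>s v\<close> record whether
      \<open>p v\<close> or \<open>q v\<close> was chosen.\<close>
    define s where "s v = w \<bullet> (slope (p v) v - slope (q v) v)" for v
    have s: "(v \<in> Y \<longrightarrow> 0 < s v) \<and> (v \<notin> Y \<longrightarrow> s v < 0)" if v: "v \<in> B'" for v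
    proof -
      have vB: "v \<in> B" "v \<in> V - {opt}" using v B'(1) optB by (auto simp: B_def)
      have "A Y v = (if v \<in> Y then p v else q v)" using vB by (simp add: A_def)
      then show ?thesis
        using w[OF vB(2), of "p v"] w[OF vB(2), of "q v"] pq[OF vB(1)]
        by (auto simp: s_def slope_def inner_diff_right)
    qed
    have "(\<Sum>v\<in>B'. l v * s v) = w \<bullet> (\<Sum>v\<in>B'. l v *\<^sub>R (slope (p v) v - slope (q v) v))"
      by (simp add: s_def inner_sum_right)
    then have zero: "(\<Sum>v\<in>B'. l v * s v) = 0" by (simp add: rel)
    \<comment> \<open>\<open>v0\<close> supplies a strictly positive term, and vanishing
      coefficients contribute 0.\<close>
    have sum_pos: "0 < (\<Sum>v\<in>B'. f v)" if f: "\<And>v. v \<in> B' \<Longrightarrow> l v \<noteq> 0 \<Longrightarrow> 0 < f v"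
      and f0: "\<And>v. l v = 0 \<Longrightarrow> f v = 0" for f :: "'a \<Rightarrow> real"
    proof (rule sum_pos2[where i = v0])
      show "0 \<le> f v" if "v \<in> B'" for v
        using f[OF that] f0[of v] by (cases "l v = 0") simp_all
    qed (use B'(3) v0 f[OF v0] in auto)
    from bad_B'(1)[OF Y] show False
    proof
      assume Yp: "Y \<inter> B' = pos"
      have "0 < l v * s v" if v: "v \<in> B'" "l v \<noteq> 0" for v
      proof -
        have "v \<in> Y \<longleftrightarrow> 0 < l v" using Yp v(1) unfolding pos_def by blast
        then show ?thesis using s[OF v(1)] v(2) by (simp add: zero_less_mult_iff) linarith
      qed
      then have "0 < (\<Sum>v\<in>B'. l v * s v)" by (rule sum_pos) simp_all
      then show False using zero by simp
    next
      assume Yn: "Y \<inter> B' = neg"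
      \<comment> \<open>Under the opposite pattern every nonzero product changes sign, so the
        negated sum is positive.\<close>
      have "0 < l v * - s v" if v: "v \<in> B'" "l v \<noteq> 0" for v
      proof -
        have "v \<in> Y \<longleftrightarrow> l v < 0" using Yn v(1) unfolding neg_def by blast
        then show ?thesis using s[OF v(1)] v(2) by (simp add: mult_less_0_iff) linarith
      qed
      then have "0 < (\<Sum>v\<in>B'. l v * - s v)" by (rule sum_pos) simp_all
      then show False using zero by (simp add: sum_negf)
    qed
  qed
  ultimately have "A ` bad \<subseteq> Arb - coh" by blast
  then have "card (coh \<union> A ` bad) \<le> card Arb" and "coh \<inter> A ` bad = {}"
    using cohArb finArb by (auto intro!: card_mono)
  moreover have "finite coh" "finite (A ` bad)"
    using cohArb \<open>A ` bad \<subseteq> Arb - coh\<close> finArb by (auto intro: finite_subset)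
  ultimately have "card coh + card bad \<le> card Arb"
    using injA by (simp add: card_Un_disjoint card_image)
  then show ?thesis
    unfolding cardbad cardArb by (simp add: coh_def B_def V_def opt_def)
qed

section \<open>Combining the facet count with the count of incoherent arborescences\<close>

theorem theorem5p2:
  fixes P :: "'a::euclidean_space set" and c :: 'a and \<eta> :: "'a \<Rightarrow> real"
    and d n m :: nat
  assumes "d = DIM('a)"
    and "simple_polytope P"
    and "n = card (vertices P)"
    and "m = card {F. F facet_of P}"
    and "n > d + 1" and "d + 1 \<ge> 4"
    and "generic P c"
    and "normalization P c \<eta>"
  shows "int (card (coherent_arborescences P c \<eta>))
    < (\<Prod>i = 1..d. int i ^ h_vector P c i) - 2 * (int n - int m - 2)"
proof -
  note P = assms(2) and c = assms(7)
  define N where "N = (\<Prod>v\<in>vertices P - {v_opt P c}. card (Nb P c v))"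
  define B where "B = {v \<in> vertices P. 2 \<le> card (Nb P c v)}"
  define W where "W = {v \<in> vertices P. card (Nb P c v) = 1}"
  have finV: "finite (vertices P)" using P by (simp add: finite_vertices simple_polytope_def)
  note opt = sink_iff_v_opt[OF P c]
  have N: "(\<Prod>i = 1..d. int i ^ h_vector P c i) = int N"
    using prod_card_Nb[OF P c] assms(1) by (simp add: N_def)
  \<comment> \<open>Every vertex is the optimum, has one upper neighbour, or has at least
    two.\<close>
  have "vertices P = insert (v_opt P c) (W \<union> B)"
  proof (intro equalityI subsetI)
    fix v assume v: "v \<in> vertices P"
    show "v \<in> insert (v_opt P c) (W \<union> B)"
    proof (cases "v = v_opt P c")
      case False
      then have "card (Nb P c v) \<noteq> 0" using opt(2)[OF v] card_Nb_minus(2)[OF P c v] by simp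
      then show ?thesis using v by (auto simp: W_def B_def)
    qed simp
  qed (use opt in \<open>auto simp: W_def B_def\<close>)
  then have "n \<le> Suc (card (W \<union> B))"
    using assms(3) finV by (simp add: card_insert_if)
  also have "\<dots> \<le> Suc (card W + card B)" by (simp add: card_Un_le)
  finally have n: "n \<le> Suc (card W + card B)" .
  have m: "d + card W \<le> m"
    using card_facets_ge[OF P c] assms(1,4) by (simp add: W_def)
  have le: "card (coherent_arborescences P c \<eta>) \<le> N"
  proof -
    have "finite (\<Pi>\<^sub>E v\<in>vertices P. if v = v_opt P c then {v} else Nb P c v)"
      using finV card_Nb_minus(2)[OF P c] by (intro finite_PiE) auto
    then show ?thesis
      using card_mono[OF _ coherent_arborescences_subset[OF opt(1)]] card_arborescences[OF finV opt(1)]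
      by (simp add: N_def)
  qed
  show ?thesis
  proof (cases "m + 2 \<le> n")
    case False
    \<comment> \<open>The subtracted term is negative, so the bound by the number of all
      arborescences is enough.\<close>
    then have "int n - int m - 2 < 0" by simp
    then show ?thesis using le N by simp
  next
    case True
    define k where "k = n - (m + 2)"
    \<comment> \<open>At least \<open>n - 1 - card W\<close> vertices lie in \<open>B\<close>, and
      \<open>card W <= m - d\<close>; with \<open>n = m + 2 + k\<close> this gives
      \<open>d + 1 + k\<close>.\<close>
    have B: "d + 1 + k \<le> card B" using True n m by (simp add: k_def)
    have "card (coherent_arborescences P c \<eta>) + 2 * 2 ^ (card B - (d + 1)) \<le> N"
      using card_coherent_arborescences_le[OF P c] B assms(1) by (simp add: N_def B_def)
    moreover have "(2::nat) ^ k \<le> 2 ^ (card B - (d + 1))"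
      using B by (intro power_increasing) auto
    \<comment> \<open>This is where strictness comes from, including the case
      \<open>k = 0\<close>.\<close>
    moreover have "k < 2 ^ k" by (rule less_exp)
    ultimately have "card (coherent_arborescences P c \<eta>) + 2 * k < N" by linarith
    then have "int (card (coherent_arborescences P c \<eta>)) + 2 * int k < int N" by linarith
    moreover have "int k = int n - int m - 2" using True by (simp add: k_def)
    ultimately show ?thesis unfolding N by simp
  qed
qed

end
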